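(* Let $M$ be a free $\mathbb{T}$-module with a bicomplex scalar product, let $m,\omega,\hbar$ be positive real numbers, let $\xi=\xi_1\mathbf{e_1}+\xi_2\mathbf{e_2}$ with $\xi_1,\xi_2$ real and $>0$, and let $X,P,H:M\to M$ be $\mathbb{T}$-linear operators satisfying assumptions (a)–(f) of the context. Put $A=\frac{1}{\sqrt{2m\hbar\omega}}(m\omega X+\mathrm{i}_1P)$ and $A^*=\frac{1}{\sqrt{2m\hbar\omega}}(m\omega X-\mathrm{i}_1P)$, and let $|E\rangle$ be an eigenket of $H$ as in assumption (e). Then there exist non-negative integers $l_1,l_2$ such that the ket $$|\phi_0\rangle:=\mathbf{e_1}A^{l_1}|E\rangle+\mathbf{e_2}A^{l_2}|E\rangle$$ is not in the null cone and satisfies $A|\phi_0\rangle=0$. Moreover, defining for every integer $l\ge 0$ $$|\phi_l\rangle:=\mathbf{e_1}(l!\,\xi_1^l)^{-1/2}(A^* )^l|\phi_0\rangle+\mathbf{e_2}(l!\,\xi_2^l)^{-1/2}(A^* )^l|\phi_0\rangle ,$$ each $|\phi_l\rangle$ is not in the null cone (so $\mathbf{e_1}|\phi_l\rangle\ne0\ne\mathbf{e_2}|\phi_l\rangle$), it is an eigenket of $H$ with $$H|\phi_l\rangle=\left(l+\tfrac12\right)\hbar\omega\,\xi\,|\phi_l\rangle ,$$ and $(|\phi_l\rangle,|\phi_{l'}\rangle)=0$ whenever $l\neq l'$.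
   Context: Bicomplex numbers: $\mathbb{T}=\{w_e+w_{1}\mathrm{i}_1+w_{2}\mathrm{i}_2+w_j\mathrm{j} : w_e,w_1,w_2,w_j\in\mathbb{R}\}$ is the commutative ring with $\mathrm{i}_1^2=\mathrm{i}_2^2=-1$, $\mathrm{j}^2=1$, $\mathrm{i}_1\mathrm{i}_2=\mathrm{j}$, $\mathrm{i}_1\mathrm{j}=-\mathrm{i}_2$, $\mathrm{i}_2\mathrm{j}=-\mathrm{i}_1$. Put $\mathbf{e_1}=(1+\mathrm{j})/2$, $\mathbf{e_2}=(1-\mathrm{j})/2$; these are idempotent, $\mathbf{e_1}+\mathbf{e_2}=1$, $\mathbf{e_1}\mathbf{e_2}=0$. Every $w\in\mathbb{T}$ is uniquely $w=z_1\mathbf{e_1}+z_2\mathbf{e_2}$ with $z_1,z_2\in\mathbb{C}(\mathrm{i}_1)=\{x+y\mathrm{i}_1:x,y\in\mathbb{R}\}$, and operations are componentwise. The conjugate is $w^\dagger=\bar z_1\mathbf{e_1}+\bar z_2\mathbf{e_2}$. $w$ is in the null cone iff $z_1=0$ or $z_2=0$ (i.e. $w$ is not invertible). $\mathbb{D}^+=\{x_1\mathbf{e_1}+x_2\mathbf{e_2}:x_1,x_2\in\mathbb{R},\ x_1,x_2\ge0\}$. Elements of a $\mathbb{T}$-module $M$ are called kets. A ket $|\psi\rangle$ is in the null cone iff $\mathbf{e_1}|\psi\rangle=0$ or $\mathbf{e_2}|\psi\rangle=0$. A bicomplex scalar product on $M$ is a map $(\cdot,\cdot):M\times M\to\mathbb{T}$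 that is additive and $\mathbb{T}$-homogeneous in the second argument, satisfies $(|\psi\rangle,|\phi\rangle)=(|\phi\rangle,|\psi\rangle)^\dagger$, and $(|\psi\rangle,|\psi\rangle)=0$ iff $|\psi\rangle=0$. An operator $B:M\to M$ is self-adjoint if $(|\psi\rangle,B|\phi\rangle)=(B|\psi\rangle,|\phi\rangle)$ for all kets. An eigenket of $B$ with eigenvalue $\lambda\in\mathbb{T}$ is a nonzero ket $|\psi\rangle$ with $B|\psi\rangle=\lambda|\psi\rangle$. A ket is normalizable if its scalar product with itself is not in the null cone. Two kets are orthogonal if their scalar product is $0$. Assumptions: (a) $H=\frac{1}{2m}P^2+\frac12m\omega^2X^2$; (b) $X,P,H$ are self-adjoint; (c) $(|\psi\rangle,|\psi\rangle)\in\mathbb{D}^+$ for every $|\psi\rangle\in M$; (d) $[X,P]=XP-PX=\mathrm{i}_1\hbar\xi I$, with $I$ the identity; (e) there is at least one normalizable eigenket $|E\rangle$ of $H$, not in the null cone, whose eigenvalue $E$ is not in the null cone; (f) eigenkets of $H$ that are not in the null cone and whose eigenvalues differ by an element not in the null cone are orthogonal. *)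

theory Defs
  imports Complex_Main
begin

section \<open>Bicomplex numbers\<close>

datatype bicomplex = Bicomplex (cmp_e: real) (cmp_1: real) (cmp_2: real) (cmp_j: real)

lemma bicomplex_eq_iff:
  "w = w' \<longleftrightarrow> cmp_e w = cmp_e w' \<and> cmp_1 w = cmp_1 w' \<and> cmp_2 w = cmp_2 w' \<and> cmp_j w = cmp_j w'"
  by (cases w; cases w') simp

instantiation bicomplex :: real_algebra_1
begin

definition "0 = Bicomplex 0 0 0 0"
definition "1 = Bicomplex 1 0 0 0"
definition "w + w' = Bicomplex (cmp_e w + cmp_e w') (cmp_1 w + cmp_1 w')
                               (cmp_2 w + cmp_2 w') (cmp_j w + cmp_j w')"
definition "- w = Bicomplex (- cmp_e w) (- cmp_1 w) (- cmp_2 w) (- cmp_j w)"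
definition "w - w' = Bicomplex (cmp_e w - cmp_e w') (cmp_1 w - cmp_1 w')
                               (cmp_2 w - cmp_2 w') (cmp_j w - cmp_j w')"
definition "w * w' = Bicomplex
   (cmp_e w * cmp_e w' - cmp_1 w * cmp_1 w' - cmp_2 w * cmp_2 w' + cmp_j w * cmp_j w')
   (cmp_e w * cmp_1 w' + cmp_1 w * cmp_e w' - cmp_2 w * cmp_j w' - cmp_j w * cmp_2 w')
   (cmp_e w * cmp_2 w' + cmp_2 w * cmp_e w' - cmp_1 w * cmp_j w' - cmp_j w * cmp_1 w')
   (cmp_e w * cmp_j w' + cmp_j w * cmp_e w' + cmp_1 w * cmp_2 w' + cmp_2 w * cmp_1 w')"
definition "scaleR r w = Bicomplex (r * cmp_e w) (r * cmp_1 w) (r * cmp_2 w) (r * cmp_j w)"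

lemmas bicomplex_defs =
  zero_bicomplex_def one_bicomplex_def plus_bicomplex_def uminus_bicomplex_def
  minus_bicomplex_def times_bicomplex_def scaleR_bicomplex_def

instance
  by standard (simp_all add: bicomplex_defs algebra_simps)

end

instance bicomplex :: comm_ring_1
  by standard (simp_all add: bicomplex_defs algebra_simps)

definition \<i>1 :: bicomplex where "\<i>1 = Bicomplex 0 1 0 0"
definition \<i>2 :: bicomplex where "\<i>2 = Bicomplex 0 0 1 0"
definition \<j> :: bicomplex where "\<j> = Bicomplex 0 0 0 1"

lemmas bicomplex_unit_defs = \<i>1_def \<i>2_def \<j>_def

lemma bicomplex_unit_mult:
  "\<i>1 * \<i>1 = -1" "\<i>2 * \<i>2 = -1" "\<j> * \<j> = 1"
  "\<i>1 * \<i>2 = \<j>" "\<i>1 * \<j> = - \<i>2" "\<i>2 * \<j> = - \<i>1"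
  by (simp_all add: bicomplex_defs bicomplex_unit_defs)

lemma bicomplex_of_real: "of_real r = Bicomplex r 0 0 0"
  by (simp add: of_real_def bicomplex_defs)

lemma bicomplex_expand:
  "Bicomplex a b c d = of_real a + of_real b * \<i>1 + of_real c * \<i>2 + of_real d * \<j>"
  by (simp add: bicomplex_of_real bicomplex_defs bicomplex_unit_defs)

definition e1 :: bicomplex where "e1 = (1 / 2) *\<^sub>R (1 + \<j>)"
definition e2 :: bicomplex where "e2 = (1 / 2) *\<^sub>R (1 - \<j>)"

lemma idempotents: "e1 * e1 = e1" "e2 * e2 = e2" "e1 + e2 = 1" "e1 * e2 = 0"
  by (simp_all add: e1_def e2_def bicomplex_defs bicomplex_unit_defs)

text \<open>The embedding of the complex numbers onto the subring of all \<open>x + y \<i>1\<close>.\<close>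

definition of_complex_i1 :: "complex \<Rightarrow> bicomplex" where
  "of_complex_i1 z = of_real (Re z) + of_real (Im z) * \<i>1"

text \<open>
  The idempotent components; the signs of \<open>cmp_2\<close> come from \<open>\<i>1 * \<j> = - \<i>2\<close>.
  They are the unique coefficients in the decomposition below.
\<close>

definition idem1 :: "bicomplex \<Rightarrow> complex" where
  "idem1 w = Complex (cmp_e w + cmp_j w) (cmp_1 w - cmp_2 w)"
definition idem2 :: "bicomplex \<Rightarrow> complex" where
  "idem2 w = Complex (cmp_e w - cmp_j w) (cmp_1 w + cmp_2 w)"

lemma idempotent_decomposition:
  "w = of_complex_i1 z1 * e1 + of_complex_i1 z2 * e2 \<longleftrightarrow> z1 = idem1 w \<and> z2 = idem2 w"
  by (auto simp: bicomplex_eq_iff bicomplex_of_real bicomplex_defs bicomplex_unit_defs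
      e1_def e2_def of_complex_i1_def idem1_def idem2_def complex_eq_iff field_simps)

lemma idem_mult: "idem1 (w * w') = idem1 w * idem1 w'" "idem2 (w * w') = idem2 w * idem2 w'"
  by (simp_all add: idem1_def idem2_def bicomplex_defs complex_eq_iff algebra_simps)

definition bconj :: "bicomplex \<Rightarrow> bicomplex" ("_\<^sup>\<dagger>" [1000] 999) where
  "w\<^sup>\<dagger> = of_complex_i1 (cnj (idem1 w)) * e1 + of_complex_i1 (cnj (idem2 w)) * e2"

definition null_cone :: "bicomplex set" where
  "null_cone = {w. idem1 w = 0 \<or> idem2 w = 0}"

lemma null_cone_iff_not_unit: "w \<in> null_cone \<longleftrightarrow> \<not> w dvd 1"
proof
  assume "w \<in> null_cone"
  moreover have "idem1 1 = 1" "idem2 1 = 1"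
    by (simp_all add: idem1_def idem2_def bicomplex_defs complex_eq_iff)
  ultimately show "\<not> w dvd 1"
    by (metis (mono_tags, lifting) dvdE idem_mult mem_Collect_eq mult_zero_left null_cone_def zero_neq_one)
next
  assume nu: "\<not> w dvd 1"
  show "w \<in> null_cone"
  proof (rule ccontr)
    assume "w \<notin> null_cone"
    then have nz: "idem1 w \<noteq> 0" "idem2 w \<noteq> 0"
      by (auto simp: null_cone_def)
    define v where "v = of_complex_i1 (inverse (idem1 w)) * e1 + of_complex_i1 (inverse (idem2 w)) * e2"
    have "idem1 v = inverse (idem1 w)" "idem2 v = inverse (idem2 w)"
      using idempotent_decomposition v_def by metis+
    then have "idem1 (w * v) = 1" "idem2 (w * v) = 1"
      using nz by (simp_all add: idem_mult)
    then have "w * v = 1"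
      by (simp add: idem1_def idem2_def bicomplex_eq_iff one_bicomplex_def complex_eq_iff)
    then show False
      using nu by (metis dvd_triv_left)
  qed
qed

definition D_plus :: "bicomplex set" where
  "D_plus = {of_real x1 * e1 + of_real x2 * e2 | x1 x2 :: real. 0 \<le> x1 \<and> 0 \<le> x2}"


section \<open>Bicomplex modules\<close>

text \<open>
  A bicomplex module is given by a type \<open>'m\<close> and a scalar multiplication \<open>scale\<close> with
  \<open>module scale\<close>; linear operators are the maps \<open>B\<close> with \<open>module_hom scale scale B\<close>.
\<close>

definition free_module :: "(bicomplex \<Rightarrow> 'm \<Rightarrow> 'm::ab_group_add) \<Rightarrow> bool" where
  "free_module scale \<longleftrightarrow> module scale \<and>
     (\<exists>B. \<not> module.dependent scale B \<and> module.span scale B = UNIV)"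

definition ket_null_cone :: "(bicomplex \<Rightarrow> 'm \<Rightarrow> 'm::ab_group_add) \<Rightarrow> 'm set" where
  "ket_null_cone scale = {\<psi>. scale e1 \<psi> = 0 \<or> scale e2 \<psi> = 0}"

definition bicomplex_scalar_product ::
  "(bicomplex \<Rightarrow> 'm \<Rightarrow> 'm::ab_group_add) \<Rightarrow> ('m \<Rightarrow> 'm \<Rightarrow> bicomplex) \<Rightarrow> bool" where
  "bicomplex_scalar_product scale ip \<longleftrightarrow>
     (\<forall>\<psi> \<phi> \<chi>. ip \<psi> (\<phi> + \<chi>) = ip \<psi> \<phi> + ip \<psi> \<chi>) \<and>
     (\<forall>\<psi> \<phi> \<alpha>. ip \<psi> (scale \<alpha> \<phi>) = \<alpha> * ip \<psi> \<phi>) \<and>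
     (\<forall>\<psi> \<phi>. ip \<psi> \<phi> = (ip \<phi> \<psi>)\<^sup>\<dagger>) \<and>
     (\<forall>\<psi>. ip \<psi> \<psi> = 0 \<longleftrightarrow> \<psi> = 0)"

definition self_adjoint :: "('m \<Rightarrow> 'm \<Rightarrow> bicomplex) \<Rightarrow> ('m \<Rightarrow> 'm) \<Rightarrow> bool" where
  "self_adjoint ip B \<longleftrightarrow> (\<forall>\<psi> \<phi>. ip \<psi> (B \<phi>) = ip (B \<psi>) \<phi>)"

definition eigenket ::
  "(bicomplex \<Rightarrow> 'm \<Rightarrow> 'm::ab_group_add) \<Rightarrow> ('m \<Rightarrow> 'm) \<Rightarrow> bicomplex \<Rightarrow> 'm \<Rightarrow> bool" where
  "eigenket scale B \<epsilon> \<psi> \<longleftrightarrow> \<psi> \<noteq> 0 \<and> B \<psi> = scale \<epsilon> \<psi>"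

definition normalizable :: "('m \<Rightarrow> 'm \<Rightarrow> bicomplex) \<Rightarrow> 'm \<Rightarrow> bool" where
  "normalizable ip \<psi> \<longleftrightarrow> ip \<psi> \<psi> \<notin> null_cone"

definition orthogonal_kets :: "('m \<Rightarrow> 'm \<Rightarrow> bicomplex) \<Rightarrow> 'm \<Rightarrow> 'm \<Rightarrow> bool" where
  "orthogonal_kets ip \<psi> \<phi> \<longleftrightarrow> ip \<psi> \<phi> = 0"

end

theory Submission imports Defs begin

text \<open>
  We have \<open>H = \<hbar>\<omega> (A\<^sup>* A + \<xi>/2)\<close> with \<open>[A, A\<^sup>*] = \<xi>\<close>, so \<open>A\<close> lowers the eigenvalues of
  \<open>A\<^sup>* A\<close> by \<open>\<xi>\<close>, starting from some \<open>\<nu>\<close> at \<open>|E\<rangle>\<close>. In each idempotent component the squared norm of \<open>A\<^bsup>l+1\<^esup>|E\<rangle>\<close> is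
  \<open>\<nu> - l \<xi>\<^sub>k\<close> times that of \<open>A\<^sup>l|E\<rangle>\<close>; since squared norms are non-negative and vanish only on
  kets that are zero in that component, the component of some \<open>A\<^sup>l|E\<rangle>\<close> vanishes. Conversely the
  squared norm of \<open>(A\<^sup>*)\<^bsup>l+1\<^esup>|\<phi>\<^sub>0\<rangle>\<close> is \<open>(l + 1) \<xi>\<^sub>k\<close> times that of \<open>(A\<^sup>*)\<^sup>l|\<phi>\<^sub>0\<rangle>\<close>, so raising never
  annihilates a component.
\<close>

section \<open>Idempotent coordinates as ring homomorphisms to the complex numbers\<close>

lemma idem_linear [simp]:
  "idem1 (w + w') = idem1 w + idem1 w'" "idem2 (w + w') = idem2 w + idem2 w'"
  "idem1 (w - w') = idem1 w - idem1 w'" "idem2 (w - w') = idem2 w - idem2 w'"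
  "idem1 (- w) = - idem1 w" "idem2 (- w) = - idem2 w"
  "idem1 (w * w') = idem1 w * idem1 w'" "idem2 (w * w') = idem2 w * idem2 w'"
  "idem1 0 = 0" "idem2 0 = 0" "idem1 1 = 1" "idem2 1 = 1"
  "idem1 (of_real r) = of_real r" "idem2 (of_real r) = of_real r"
  by (simp_all add: idem_mult)
    (simp_all add: idem1_def idem2_def bicomplex_of_real bicomplex_defs complex_eq_iff)

lemma idem_of_nat [simp]: "idem1 (of_nat n) = of_nat n" "idem2 (of_nat n) = of_nat n"
  using idem_linear(13,14)[of "real n"] by simp_all

lemma idem_units [simp]:
  "idem1 e1 = 1" "idem2 e1 = 0" "idem1 e2 = 0" "idem2 e2 = 1" "idem1 \<i>1 = \<i>" "idem2 \<i>1 = \<i>"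
  by (simp_all add: idem1_def idem2_def bicomplex_defs bicomplex_unit_defs e1_def e2_def complex_eq_iff)

lemma idem_of_complex [simp]: "idem1 (of_complex_i1 z) = z" "idem2 (of_complex_i1 z) = z"
  by (simp_all add: of_complex_i1_def complex_eq_iff)

lemma idem_bconj [simp]: "idem1 (w\<^sup>\<dagger>) = cnj (idem1 w)" "idem2 (w\<^sup>\<dagger>) = cnj (idem2 w)"
  by (simp_all add: bconj_def)

lemma bicomplex_eq_iff_idem: "w = w' \<longleftrightarrow> idem1 w = idem1 w' \<and> idem2 w = idem2 w'"
  by (metis idempotent_decomposition)

text \<open>Pairs each idempotent with its coordinate map, so that one argument serves both
  components.\<close>

definition idempotent_component :: "bicomplex \<Rightarrow> (bicomplex \<Rightarrow> complex) \<Rightarrow> bool" where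
  "idempotent_component e p \<longleftrightarrow> e = e1 \<and> p = idem1 \<or> e = e2 \<and> p = idem2"

lemma idempotent_component_linear:
  assumes "idempotent_component e p"
  shows "p (w + w') = p w + p w'" "p (w - w') = p w - p w'" "p (w * w') = p w * p w'"
    "p (of_real r) = of_real r" "p 0 = 0" "p e = 1" "e * e = e" "e\<^sup>\<dagger> = e" "e * w = 0 \<longleftrightarrow> p w = 0"
  using assms by (auto simp: idempotent_component_def bicomplex_eq_iff_idem)

lemma idempotent_component_D_plus:
  assumes "idempotent_component e p" "w \<in> D_plus"
  shows "p w = of_real (Re (p w))" "Re (p w) \<ge> 0"
  using assms by (auto simp: idempotent_component_def D_plus_def)

section \<open>Positivity of the scalar product in each component\<close>

locale bicomplex_inner_product = module scale
  for scale :: "bicomplex \<Rightarrow> 'm \<Rightarrow> 'm::ab_group_add" (infixr "*s" 75) +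
  fixes ip :: "'m \<Rightarrow> 'm \<Rightarrow> bicomplex"
  assumes scalar_product: "bicomplex_scalar_product scale ip"
    and ip_self_D_plus: "ip \<psi> \<psi> \<in> D_plus"
begin

lemma ip_add_right: "ip \<psi> (\<phi> + \<chi>) = ip \<psi> \<phi> + ip \<psi> \<chi>"
  and ip_scale_right: "ip \<psi> (\<alpha> *s \<phi>) = \<alpha> * ip \<psi> \<phi>"
  and ip_commute: "ip \<psi> \<phi> = (ip \<phi> \<psi>)\<^sup>\<dagger>"
  and ip_self_eq_0_iff: "ip \<psi> \<psi> = 0 \<longleftrightarrow> \<psi> = 0"
  using scalar_product unfolding bicomplex_scalar_product_def by blast+

lemma ip_add_left: "ip (\<phi> + \<chi>) \<psi> = ip \<phi> \<psi> + ip \<chi> \<psi>"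
  by (subst (1 2 3) ip_commute) (simp add: ip_add_right bicomplex_eq_iff_idem)

lemma ip_scale_left: "ip (\<alpha> *s \<phi>) \<psi> = \<alpha>\<^sup>\<dagger> * ip \<phi> \<psi>"
  by (subst (1 2) ip_commute) (simp add: ip_scale_right bicomplex_eq_iff_idem)

text \<open>Since \<open>e\<close> is idempotent and fixed by conjugation,
  \<open>e *s \<psi>\<close> has squared norm \<open>e * ip \<psi> \<psi>\<close>, so definiteness
  passes to each component.\<close>

lemma component_eq_0_iff:
  assumes "idempotent_component e p"
  shows "e *s \<psi> = 0 \<longleftrightarrow> p (ip \<psi> \<psi>) = 0"
proof -
  note [simp] = idempotent_component_linear[OF assms]
  have "e *s \<psi> = 0 \<longleftrightarrow> e * (e * ip \<psi> \<psi>) = 0"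
    by (simp only: ip_self_eq_0_iff[symmetric, of "e *s \<psi>"] ip_scale_left ip_scale_right
        idempotent_component_linear(8)[OF assms])
  then show ?thesis
    by (simp flip: mult.assoc)
qed

lemma component_norm_pos:
  assumes "idempotent_component e p" "e *s \<psi> \<noteq> 0"
  shows "Re (p (ip \<psi> \<psi>)) > 0"
proof -
  have "Re (p (ip \<psi> \<psi>)) \<ge> 0" "Re (p (ip \<psi> \<psi>)) \<noteq> 0"
    using idempotent_component_D_plus[OF assms(1) ip_self_D_plus] component_eq_0_iff[OF assms(1)] assms(2)
    by (metis of_real_0)+
  then show ?thesis by simp
qed

end

section \<open>Ladder operators, abstracted from \<open>X\<close>, \<open>P\<close> and
  \<open>H\<close>\<close>

locale bicomplex_ladder = bicomplex_inner_product scale ip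
  for scale :: "bicomplex \<Rightarrow> 'm \<Rightarrow> 'm::ab_group_add" (infixr "*s" 75) and ip +
  fixes A Astar :: "'m \<Rightarrow> 'm" and \<xi> :: bicomplex and \<xi>1 \<xi>2 :: real
  assumes xi: "\<xi> = of_real \<xi>1 * e1 + of_real \<xi>2 * e2" and xi_pos: "\<xi>1 > 0" "\<xi>2 > 0"
    and A_hom: "module_hom scale scale A" and Astar_hom: "module_hom scale scale Astar"
    and A_adjoint: "ip \<psi> (A \<phi>) = ip (Astar \<psi>) \<phi>"
    and commutator: "A (Astar \<psi>) = Astar (A \<psi>) + \<xi> *s \<psi>"
begin

sublocale A: module_hom scale scale A by (rule A_hom)
sublocale Astar: module_hom scale scale Astar by (rule Astar_hom)

lemma Astar_adjoint: "ip \<psi> (Astar \<phi>) = ip (A \<psi>) \<phi>"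
  by (metis ip_commute A_adjoint)

lemma component_xi:
  assumes "idempotent_component e p"
  obtains r :: real where "r > 0" "p \<xi> = of_real r"
  using assms xi_pos by (auto simp: idempotent_component_def xi)

text \<open>The commutator gives \<open>Astar A A = A Astar A - \<xi> A\<close>, so every further
  \<open>A\<close> subtracts one \<open>\<xi>\<close>.\<close>

lemma number_lower:
  assumes "Astar (A \<psi>) = \<nu> *s \<psi>"
  shows "Astar (A ((A ^^ l) \<psi>)) = (\<nu> - of_nat l * \<xi>) *s (A ^^ l) \<psi>"
proof (induction l)
  case (Suc l)
  let ?\<chi> = "(A ^^ l) \<psi>"
  have "Astar (A (A ?\<chi>)) = A (Astar (A ?\<chi>)) - \<xi> *s A ?\<chi>"
    using commutator[of "A ?\<chi>"] by simp
  also have "\<dots> = (\<nu> - of_nat l * \<xi> - \<xi>) *s A ?\<chi>"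
    by (simp add: Suc A.scale A.diff scale_left_diff_distrib)
  finally show ?case by (simp add: algebra_simps)
qed (simp add: assms)

text \<open>The value starts at 0 because \<open>A\<close> kills \<open>\<psi>\<close>, and every
  \<open>Astar\<close> adds one \<open>\<xi>\<close>.\<close>

lemma number_raise:
  assumes "A \<psi> = 0"
  shows "Astar (A ((Astar ^^ l) \<psi>)) = (of_nat l * \<xi>) *s (Astar ^^ l) \<psi>"
proof (induction l)
  case (Suc l)
  then show ?case
    by (simp add: commutator[of "(Astar ^^ l) \<psi>"] Astar.add Astar.scale
        scale_left_distrib distrib_right)
qed (simp add: assms Astar.zero)

lemma lowering_terminates:
  assumes ep: "idempotent_component e p" and num: "Astar (A \<psi>) = \<nu> *s \<psi>" and nz: "e *s \<psi> \<noteq> 0"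
  obtains l where "e *s (A ^^ l) \<psi> \<noteq> 0" "e *s A ((A ^^ l) \<psi>) = 0"
proof -
  note p = idempotent_component_linear[OF ep]
  obtain r where r: "r > 0" "p \<xi> = of_real r" using component_xi[OF ep] .
  define q where "q l = Re (p (ip ((A ^^ l) \<psi>) ((A ^^ l) \<psi>)))" for l
  \<comment> \<open>The coordinate of \<open>\<nu>\<close> is not assumed real; taking real parts
    suffices because squared norms and \<open>p \<xi>\<close> are real.\<close>
  have step: "q (Suc l) = (Re (p \<nu>) - real l * r) * q l" for l
  proof -
    let ?\<chi> = "(A ^^ l) \<psi>"
    have "ip (A ?\<chi>) (A ?\<chi>) = (\<nu> - of_real (real l) * \<xi>) * ip ?\<chi> ?\<chi>"
      by (simp add: Astar_adjoint[symmetric] number_lower[OF num] ip_scale_right)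
    moreover have "p (ip ?\<chi> ?\<chi>) = of_real (q l)"
      unfolding q_def by (rule idempotent_component_D_plus(1)[OF ep ip_self_D_plus])
    ultimately have "p (ip (A ?\<chi>) (A ?\<chi>)) = (p \<nu> - of_real (real l) * of_real r) * of_real (q l)"
      by (simp only: p r)
    then show ?thesis
      by (simp add: q_def[of "Suc l"])
  qed
  have "\<exists>l. e *s (A ^^ l) \<psi> = 0"
  proof (rule ccontr)
    assume "\<not> ?thesis"
    then have pos: "q l > 0" for l
      using component_norm_pos[OF ep] by (simp add: q_def)
    \<comment> \<open>For such an \<open>l\<close> the factor in \<open>step\<close> is negative
      while \<open>q l\<close> is positive.\<close>
    obtain l where "Re (p \<nu>) < real l * r"
      using reals_Archimedean3[OF r(1)] by blast
    then have "q (Suc l) < 0"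
      unfolding step by (simp add: mult_neg_pos pos)
    then show False
      using pos[of "Suc l"] by simp
  qed
  \<comment> \<open>The least vanishing index is not 0 by \<open>nz\<close>; its predecessor is the
    required index.\<close>
  then obtain l where l: "e *s (A ^^ l) \<psi> = 0" "\<forall>k<l. e *s (A ^^ k) \<psi> \<noteq> 0"
    using exists_least_iff[of "\<lambda>l. e *s (A ^^ l) \<psi> = 0"] by blast
  then obtain k where "l = Suc k"
    using nz by (cases l) auto
  then show ?thesis
    using l that[of k] by simp
qed

lemma raising_nonzero:
  assumes ep: "idempotent_component e p" and ground: "A \<psi> = 0" and nz: "e *s \<psi> \<noteq> 0"
  shows "e *s (Astar ^^ l) \<psi> \<noteq> 0"
proof (induction l)
  case (Suc l)
  note p = idempotent_component_linear[OF ep]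
  obtain r where r: "r > 0" "p \<xi> = of_real r" using component_xi[OF ep] .
  let ?\<chi> = "(Astar ^^ l) \<psi>"
  have "ip (Astar ?\<chi>) (Astar ?\<chi>) = ip ?\<chi> (A (Astar ?\<chi>))"
    by (simp add: A_adjoint)
  \<comment> \<open>\<open>A Astar = Astar A + \<xi>\<close>: the first term contributes
    \<open>l\<close> copies of \<open>\<xi>\<close>, the commutator one more.\<close>
  also have "\<dots> = of_real (real (Suc l)) * \<xi> * ip ?\<chi> ?\<chi>"
    by (simp add: commutator[of ?\<chi>] number_raise[OF ground] ip_add_right ip_scale_right algebra_simps)
  finally have "p (ip (Astar ?\<chi>) (Astar ?\<chi>)) = of_real (real (Suc l)) * of_real r * p (ip ?\<chi> ?\<chi>)"
    by (simp only: p r)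
  then show ?case
    using Suc r(1) component_eq_0_iff[OF ep] by (simp del: of_nat_Suc)
qed (use nz in simp)

end

section \<open>The bicomplex harmonic oscillator\<close>

theorem mainTheorem1:
  fixes scale :: "bicomplex \<Rightarrow> 'm \<Rightarrow> 'm::ab_group_add" (infixr "*s" 75)
    and ip :: "'m \<Rightarrow> 'm \<Rightarrow> bicomplex"
    and m \<omega> hbar \<xi>1 \<xi>2 :: real
    and \<xi> E :: bicomplex
    and X P H A Astar :: "'m \<Rightarrow> 'm"
    and ket_E :: 'm
  assumes "free_module scale"
    and "bicomplex_scalar_product scale ip"
    and "m > 0" and "\<omega> > 0" and "hbar > 0"
    and "\<xi>1 > 0" and "\<xi>2 > 0" and "\<xi> = of_real \<xi>1 * e1 + of_real \<xi>2 * e2"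
    and "module_hom scale scale X" and "module_hom scale scale P" and "module_hom scale scale H"
    and a: "\<forall>\<psi>. H \<psi> = of_real (1 / (2 * m)) *s P (P \<psi>) + of_real (1 / 2 * m * \<omega>\<^sup>2) *s X (X \<psi>)"
    and b: "self_adjoint ip X" "self_adjoint ip P" "self_adjoint ip H"
    and c: "\<forall>\<psi>. ip \<psi> \<psi> \<in> D_plus"
    and d: "\<forall>\<psi>. X (P \<psi>) - P (X \<psi>) = (\<i>1 * of_real hbar * \<xi>) *s \<psi>"
    and e: "eigenket scale H E ket_E" "normalizable ip ket_E"
           "ket_E \<notin> ket_null_cone scale" "E \<notin> null_cone"
    and f: "\<forall>\<psi> \<phi> \<epsilon> \<mu>. eigenket scale H \<epsilon> \<psi> \<and> eigenket scale H \<mu> \<phi> \<and>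
              \<psi> \<notin> ket_null_cone scale \<and> \<phi> \<notin> ket_null_cone scale \<and> \<epsilon> - \<mu> \<notin> null_cone
              \<longrightarrow> orthogonal_kets ip \<psi> \<phi>"
    and A: "A = (\<lambda>\<psi>. of_real (1 / sqrt (2 * m * hbar * \<omega>)) *s
                      (of_real (m * \<omega>) *s X \<psi> + \<i>1 *s P \<psi>))"
    and Astar: "Astar = (\<lambda>\<psi>. of_real (1 / sqrt (2 * m * hbar * \<omega>)) *s
                      (of_real (m * \<omega>) *s X \<psi> - \<i>1 *s P \<psi>))"
  shows "\<exists>l1 l2 :: nat.
    let \<phi>0 = e1 *s (A ^^ l1) ket_E + e2 *s (A ^^ l2) ket_E;
        \<phi> = (\<lambda>l::nat. e1 *s of_real (1 / sqrt (fact l * \<xi>1 ^ l)) *s (Astar ^^ l) \<phi>0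
                    + e2 *s of_real (1 / sqrt (fact l * \<xi>2 ^ l)) *s (Astar ^^ l) \<phi>0)
    in \<phi>0 \<notin> ket_null_cone scale \<and> A \<phi>0 = 0 \<and>
       (\<forall>l. \<phi> l \<notin> ket_null_cone scale \<and>
            eigenket scale H (of_real ((real l + 1 / 2) * hbar * \<omega>) * \<xi>) (\<phi> l)) \<and>
       (\<forall>l l'. l \<noteq> l' \<longrightarrow> orthogonal_kets ip (\<phi> l) (\<phi> l'))"
proof -
  interpret module scale
    using assms(1) by (simp add: free_module_def)
  interpret bicomplex_inner_product scale ip
    by unfold_locales (use assms(2) c in auto)
  interpret X: module_hom scale scale X by fact
  interpret P: module_hom scale scale P by fact
  interpret H: module_hom scale scale H by fact
  define s where "s = 1 / sqrt (2 * m * hbar * \<omega>)"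
  have s2: "s * s = 1 / (2 * m * hbar * \<omega>)"
    using assms(3-5) by (simp add: s_def)
  define t where "t = (of_real (s * m * \<omega>) :: bicomplex)"
  define u where "u = of_real s * \<i>1"
  have A_eq: "A \<psi> = t *s X \<psi> + u *s P \<psi>" for \<psi>
    unfolding A s_def[symmetric] t_def u_def
    by (simp only: scale_right_distrib scale_scale of_real_mult mult.assoc)
  have Astar_eq: "Astar \<psi> = t *s X \<psi> - u *s P \<psi>" for \<psi>
    unfolding Astar s_def[symmetric] t_def u_def
    by (simp only: scale_right_diff_distrib scale_scale of_real_mult mult.assoc)
  \<comment> \<open>\<open>t * t\<close> and \<open>- (u * u)\<close> are the coefficients of
    \<open>X X\<close> and \<open>P P\<close> in \<open>H\<close> divided by
    \<open>hbar * \<omega>\<close>; the sign comes from the square of \<open>\<i>1\<close>.\<close>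
  have tt: "t * t = of_real (1 / (hbar * \<omega>)) * of_real (1 / 2 * m * \<omega>\<^sup>2)"
  proof -
    have "s * m * \<omega> * (s * m * \<omega>) = (s * s) * (m * \<omega>) * (m * \<omega>)" by simp
    also have "\<dots> = 1 / (hbar * \<omega>) * (1 / 2 * m * \<omega>\<^sup>2)"
      using assms(3-5) by (simp add: s2 power2_eq_square)
    finally show ?thesis by (simp only: t_def flip: of_real_mult)
  qed
  have uu: "u * u = - (of_real (1 / (hbar * \<omega>)) * of_real (1 / (2 * m)))"
  proof -
    have "s * s = 1 / (hbar * \<omega>) * (1 / (2 * m))" by (simp add: s2)
    moreover have "u * u = - of_real (s * s)"
      by (simp add: u_def bicomplex_eq_iff_idem complex_eq_iff)
    ultimately show ?thesis by (simp only: of_real_mult)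
  qed
  have tu: "t * u * (\<i>1 * of_real hbar * \<xi>) = - (of_real (1 / 2) * \<xi>)"
  proof -
    have "s * m * \<omega> * s * hbar = (s * s) * m * \<omega> * hbar" by simp
    also have "\<dots> = 1 / 2"
      using assms(3-5) by (simp add: s2)
    finally have *: "of_real (s * m * \<omega> * s * hbar) = (of_real (1 / 2) :: bicomplex)" by (simp only:)
    have "t * u * (\<i>1 * of_real hbar * \<xi>) = of_real (s * m * \<omega> * s * hbar) * (\<i>1 * \<i>1) * \<xi>"
      by (simp add: t_def u_def ac_simps)
    then show ?thesis by (simp only: *) (simp add: bicomplex_unit_mult)
  qed
  \<comment> \<open>Puts mixed products in the order \<open>P X\<close>; they then cancel in
    \<open>A Astar\<close> and \<open>Astar A\<close>, leaving \<open>\<xi>/2\<close> with opposite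
    signs.\<close>
  have XP: "(t * u) *s X (P \<psi>) = (t * u) *s P (X \<psi>) - (of_real (1 / 2) * \<xi>) *s \<psi>" for \<psi>
  proof -
    have "X (P \<psi>) = P (X \<psi>) + (\<i>1 * of_real hbar * \<xi>) *s \<psi>"
      using d by (simp add: algebra_simps)
    then show ?thesis
      by (simp only: scale_right_distrib scale_scale tu) simp
  qed
  have half: "(of_real (1 / 2) * \<xi>) *s \<psi> + (of_real (1 / 2) * \<xi>) *s \<psi> = \<xi> *s \<psi>" for \<psi>
    by (simp flip: scale_left_distrib distrib_right of_real_add)
  have AAs: "A (Astar \<psi>) = (t * t) *s X (X \<psi>) - (u * u) *s P (P \<psi>) + (of_real (1 / 2) * \<xi>) *s \<psi>" for \<psi>
    by (simp add: A_eq Astar_eq X.diff P.diff X.scale P.scale scale_right_diff_distrib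
        XP mult.commute[of u t])
  have AsA: "Astar (A \<psi>) = (t * t) *s X (X \<psi>) - (u * u) *s P (P \<psi>) - (of_real (1 / 2) * \<xi>) *s \<psi>" for \<psi>
    by (simp add: A_eq Astar_eq X.add P.add X.scale P.scale scale_right_distrib
        XP mult.commute[of u t])
  have adj: "ip \<psi> (A \<phi>) = ip (Astar \<psi>) \<phi>" for \<psi> \<phi>
  proof -
    \<comment> \<open>\<open>t\<close> is real and \<open>u\<close> a real multiple of
      \<open>\<i>1\<close>, so conjugation flips only the \<open>P\<close> term, turning
      \<open>A\<close> into \<open>Astar\<close>.\<close>
    have tu_conj: "t\<^sup>\<dagger> = t" "(- u)\<^sup>\<dagger> = u"
      by (simp_all add: t_def u_def bicomplex_eq_iff_idem)
    have "Astar \<psi> = t *s X \<psi> + (- u) *s P \<psi>" by (simp add: Astar_eq)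
    then show ?thesis
      using b by (simp add: A_eq ip_add_right ip_scale_right ip_add_left ip_scale_left tu_conj
          self_adjoint_def del: scale_minus_left)
  qed
  interpret bicomplex_ladder scale ip A Astar \<xi> \<xi>1 \<xi>2
  proof unfold_locales
    show "\<xi> = of_real \<xi>1 * e1 + of_real \<xi>2 * e2" "\<xi>1 > 0" "\<xi>2 > 0" by fact+
    show "ip \<psi> (A \<phi>) = ip (Astar \<psi>) \<phi>" for \<psi> \<phi> by (rule adj)
    show "A (Astar \<psi>) = Astar (A \<psi>) + \<xi> *s \<psi>" for \<psi>
      by (simp only: AAs AsA half[symmetric]) simp
  qed (simp_all add: A_eq Astar_eq X.add P.add X.scale P.scale algebra_simps)

  let ?hw = "of_real (hbar * \<omega>) :: bicomplex"
  have hw: "?hw * of_real (1 / (hbar * \<omega>)) = 1"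
    using assms(4,5) by (simp flip: of_real_mult)
  have H_eq: "H \<psi> = ?hw *s (Astar (A \<psi>) + (of_real (1 / 2) * \<xi>) *s \<psi>)" for \<psi>
    using a hw by (simp add: AsA tt uu scale_right_distrib mult.assoc[symmetric] del: of_real_mult of_real_divide)
  \<comment> \<open>Solves \<open>E = hbar \<omega> (\<nu> + \<xi>/2)\<close>, as dictated by
    \<open>H_eq\<close>.\<close>
  define \<nu> where "\<nu> = of_real (1 / (hbar * \<omega>)) * E - of_real (1 / 2) * \<xi>"
  have num: "Astar (A ket_E) = \<nu> *s ket_E"
  proof -
    have "of_real (1 / (hbar * \<omega>)) *s H ket_E = Astar (A ket_E) + (of_real (1 / 2) * \<xi>) *s ket_E"
      using hw by (simp only: H_eq scale_scale mult.commute) simp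
    moreover have "H ket_E = E *s ket_E"
      using e(1) by (simp add: eigenket_def)
    ultimately show ?thesis
      by (simp add: \<nu>_def scale_left_diff_distrib)
  qed
  have c1: "idempotent_component e1 idem1" and c2: "idempotent_component e2 idem2"
    by (simp_all add: idempotent_component_def)
  have nz: "e1 *s ket_E \<noteq> 0" "e2 *s ket_E \<noteq> 0"
    using e(3) by (auto simp: ket_null_cone_def)
  obtain l1 where l1: "e1 *s (A ^^ l1) ket_E \<noteq> 0" "e1 *s A ((A ^^ l1) ket_E) = 0"
    using lowering_terminates[OF c1 num nz(1)] .
  obtain l2 where l2: "e2 *s (A ^^ l2) ket_E \<noteq> 0" "e2 *s A ((A ^^ l2) ket_E) = 0"
    using lowering_terminates[OF c2 num nz(2)] .
  define \<phi>0 where "\<phi>0 = e1 *s (A ^^ l1) ket_E + e2 *s (A ^^ l2) ket_E"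
  define n1 n2 where "n1 l = 1 / sqrt (fact l * \<xi>1 ^ l)" and "n2 l = 1 / sqrt (fact l * \<xi>2 ^ l)"
    for l :: nat
  define \<phi> where "\<phi> = (\<lambda>l::nat. e1 *s of_real (n1 l) *s (Astar ^^ l) \<phi>0
                    + e2 *s of_real (n2 l) *s (Astar ^^ l) \<phi>0)"
  have orth: "e2 * e1 = 0" by (simp add: bicomplex_eq_iff_idem)
  have comp0: "e1 *s \<phi>0 \<noteq> 0" "e2 *s \<phi>0 \<noteq> 0"
    using l1 l2 by (simp_all add: \<phi>0_def scale_right_distrib idempotents orth)
  \<comment> \<open>By linearity \<open>A\<close> acts on each component separately, so
    \<open>l1\<close> and \<open>l2\<close> may differ.\<close>
  have ground: "A \<phi>0 = 0"
    using l1 l2 by (simp add: \<phi>0_def A.add A.scale)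
  have n_nz: "n1 l \<noteq> 0" "n2 l \<noteq> 0" for l
    using assms(6,7) by (simp_all add: n1_def n2_def)
  \<comment> \<open>A nonzero real is a unit, so the normalising factors annihilate nothing.\<close>
  have scaled_nz: "e *s of_real r *s \<psi> \<noteq> 0" if "e *s \<psi> \<noteq> 0" "r \<noteq> 0" for e r \<psi>
  proof
    assume "e *s of_real r *s \<psi> = 0"
    then have "of_real (1 / r) *s of_real r *s e *s \<psi> = 0"
      by (simp add: ac_simps)
    moreover have "of_real (1 / r) * of_real r = (1 :: bicomplex)"
      using that(2) by (simp flip: of_real_mult)
    ultimately show False
      using that(1) by (metis scale_scale scale_one)
  qed
  have comp: "\<phi> l \<notin> ket_null_cone scale" for l
  proof -
    have "e1 *s \<phi> l = e1 *s of_real (n1 l) *s (Astar ^^ l) \<phi>0"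
      "e2 *s \<phi> l = e2 *s of_real (n2 l) *s (Astar ^^ l) \<phi>0"
      by (simp_all add: \<phi>_def scale_right_distrib idempotents orth flip: mult.assoc)
    then show ?thesis
      using scaled_nz[OF raising_nonzero[OF c1 ground comp0(1)] n_nz(1)]
        scaled_nz[OF raising_nonzero[OF c2 ground comp0(2)] n_nz(2)]
      by (simp add: ket_null_cone_def del: scale_scale)
  qed
  define \<epsilon> where "\<epsilon> l = of_real ((real l + 1 / 2) * hbar * \<omega>) * \<xi>" for l
  have eig: "eigenket scale H (\<epsilon> l) (\<phi> l)" for l
  proof -
    have "?hw * (of_nat l * \<xi> + of_real (1 / 2) * \<xi>) = \<epsilon> l"
      by (simp add: \<epsilon>_def bicomplex_eq_iff_idem algebra_simps)
    then have "H ((Astar ^^ l) \<phi>0) = \<epsilon> l *s (Astar ^^ l) \<phi>0"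
      by (simp only: H_eq number_raise[OF ground] scale_left_distrib[symmetric] scale_scale)
    \<comment> \<open>Both summands of \<open>\<phi> l\<close> are scalar multiples of one eigenket,
      so they share the eigenvalue.\<close>
    then have "H (\<phi> l) = \<epsilon> l *s \<phi> l"
      by (simp add: \<phi>_def H.add H.scale scale_right_distrib ac_simps)
    moreover have "\<phi> l \<noteq> 0"
      using comp[of l] by (auto simp: ket_null_cone_def)
    ultimately show ?thesis by (simp add: eigenket_def)
  qed
  have "orthogonal_kets ip (\<phi> l) (\<phi> l')" if "l \<noteq> l'" for l l'
  proof -
    have "\<epsilon> l - \<epsilon> l' = of_real ((real l - real l') * hbar * \<omega>) * \<xi>"
      by (simp add: \<epsilon>_def algebra_simps)
    \<comment> \<open>Both coordinates of \<open>\<xi>\<close> are positive and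
      \<open>l \<noteq> l'\<close>, so the difference has no vanishing coordinate and
      \<open>f\<close> applies.\<close>
    then have "\<epsilon> l - \<epsilon> l' \<notin> null_cone"
      using that assms(3-8) by (simp add: null_cone_def)
    then show ?thesis
      using f eig comp by blast
  qed
  then show ?thesis
    using comp0 ground comp eig
    unfolding Let_def \<phi>_def \<epsilon>_def n1_def n2_def \<phi>0_def ket_null_cone_def by blast
qed

end
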